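(* Let $w_1,w_2,w_3$ be any positive integers, let $y\in\mathbb{Z}_p$, and let $n\ge 0$ be an integer. Then \begin{align*} &\sum_{k+l+m=n}\binom{n}{k,l,m}E_{k,\chi,\xi^{w_3}}(w_1y)E_{l,\chi,\xi^{w_1}}(w_2y)E_{m,\chi,\xi^{w_2}}(w_3y)\,w_{3}^{k}w_{1}^{l}w_{2}^{m}\\ =&\sum_{k+l+m=n}\binom{n}{k,l,m}E_{k,\chi,\xi^{w_2}}(w_1y)E_{l,\chi,\xi^{w_1}}(w_3y)E_{m,\chi,\xi^{w_3}}(w_2y)\,w_{2}^{k}w_{1}^{l}w_{3}^{m}. \end{align*}
   Context: Let $p$ be a fixed odd prime, $\mathbb{Z}_p$ the $p$-adic integers, $\mathbb{C}_p$ the completion of an algebraic closure of $\mathbb{Q}_p$. Let $\xi\in\mathbb{C}_p$ be a fixed ramified root of unity, i.e. $\xi^{p^s}=1$ for some positive integer $s$. Let $d$ be a fixed odd positive integer and $\chi$ a primitive Dirichlet character of conductor $d$, regarded as a function on the integers (periodic mod $d$, zero on integers not coprime to $d$) with values in $\mathbb{C}_p$ via a fixed embedding $\overline{\mathbb{Q}}\to\mathbb{C}_p$. For a ramified root of unity $\zeta$ (e.g. $\zeta=\xi^{w}$), the generalized twisted Euler polynomials $E_{n,\chi,\zeta}(x)$ are the polynomials in $x$ defined by $$\frac{2e^{xt}}{\zeta^d e^{dt}+1}\sum_{a=0}^{d-1}(-1)^a\chi(a)\zeta^a e^{at}=\sum_{n=0}^{\infty}E_{n,\chi,\zeta}(x)\frac{t^n}{n!}.$$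 The sums are over nonnegative integers $k,l,m$ with $k+l+m=n$, and $\binom{n}{k,l,m}=\frac{n!}{k!\,l!\,m!}$. *)

theory Defs
  imports
    "HOL-Analysis.Abstract_Metric_Spaces"
    "HOL-Computational_Algebra.Computational_Algebra"
    "HOL-Number_Theory.Cong"
begin

section \<open>The field of $p$-adic complex numbers\<close>

text \<open>
  A field with absolute value is recognised as $\mathbb{C}_p$, uniquely up to isometric
  isomorphism, by being the completion of an algebraic closure of $\mathbb{Q}_p$, where
  $\mathbb{Q}_p$ is the completion of $\mathbb{Q}$ for the $p$-adic absolute value.
  Both completions are taken inside a complete field: $\mathbb{Q}_p$ is the closure of
  $\mathbb{Q}$, and $\mathbb{C}_p$ is the closure of an algebraic closure of $\mathbb{Q}_p$.
\<close>

definition abs_dist :: "('c::field \<Rightarrow> real) \<Rightarrow> 'c \<Rightarrow> 'c \<Rightarrow> real" where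
  "abs_dist v x y = v (x - y)"

definition abs_closure :: "('c::field \<Rightarrow> real) \<Rightarrow> 'c set \<Rightarrow> 'c set" where
  "abs_closure v S = Metric_space.mtopology UNIV (abs_dist v) closure_of S"

definition nonarch_absolute_value :: "('c::field \<Rightarrow> real) \<Rightarrow> bool" where
  "nonarch_absolute_value v \<longleftrightarrow>
     (\<forall>x. 0 \<le> v x) \<and> (\<forall>x. v x = 0 \<longleftrightarrow> x = 0) \<and>
     (\<forall>x y. v (x * y) = v x * v y) \<and> (\<forall>x y. v (x + y) \<le> max (v x) (v y))"

lemma nonarch_absolute_value_Metric_space:
  assumes "nonarch_absolute_value v"
  shows "Metric_space UNIV (abs_dist v)"
proof -
  have nn: "0 \<le> v x" and z: "v x = 0 \<longleftrightarrow> x = 0" and m: "v (x * y) = v x * v y"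
    and u: "v (x + y) \<le> max (v x) (v y)" for x y
    using assms by (auto simp: nonarch_absolute_value_def)
  have "v 1 = 1" using m[of 1 1] z[of 1] by simp
  then have "v (-1) * v (-1) = 1" using m[of "-1" "-1"] by simp
  then have "(v (-1))\<^sup>2 = 1" by (simp add: power2_eq_square)
  then have "v (-1) = 1" using nn[of "-1"] by (auto simp: power2_eq_1_iff)
  then have neg: "v (- x) = v x" for x using m[of "-1" x] by simp
  show ?thesis
  proof
    fix x y w :: 'a
    show "0 \<le> abs_dist v x y" by (simp add: abs_dist_def nn)
    show "abs_dist v x y = abs_dist v y x"
      unfolding abs_dist_def using neg[of "x - y"] by simp
    show "abs_dist v x y = 0 \<longleftrightarrow> x = y" by (simp add: abs_dist_def z)
    show "abs_dist v x w \<le> abs_dist v x y + abs_dist v y w"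
      unfolding abs_dist_def using u[of "x - y" "y - w"] nn[of "x - y"] nn[of "y - w"] by simp
  qed
qed

definition is_subfield :: "'c::field set \<Rightarrow> bool" where
  "is_subfield F \<longleftrightarrow> 0 \<in> F \<and> 1 \<in> F \<and>
     (\<forall>x\<in>F. \<forall>y\<in>F. x - y \<in> F \<and> x * y \<in> F) \<and> (\<forall>x\<in>F. inverse x \<in> F)"

definition poly_over :: "'c::field set \<Rightarrow> 'c poly \<Rightarrow> bool" where
  "poly_over F q \<longleftrightarrow> (\<forall>i. coeff q i \<in> F)"

definition is_algebraic_closure :: "'c::field set \<Rightarrow> 'c set \<Rightarrow> bool" where
  "is_algebraic_closure F A \<longleftrightarrow> is_subfield A \<and> F \<subseteq> A \<and>
     (\<forall>x\<in>A. \<exists>q. q \<noteq> 0 \<and> poly_over F q \<and> poly q x = 0) \<and>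
     (\<forall>q. poly_over A q \<and> degree q > 0 \<longrightarrow> (\<exists>x\<in>A. poly q x = 0))"

definition padic_rationals :: "('c::field_char_0 \<Rightarrow> real) \<Rightarrow> 'c set" where
  "padic_rationals v = abs_closure v \<rat>"

definition padic_integers :: "('c::field_char_0 \<Rightarrow> real) \<Rightarrow> 'c set" where
  "padic_integers v = {x \<in> padic_rationals v. v x \<le> 1}"

definition padic_complex_field :: "nat \<Rightarrow> ('c::field_char_0 \<Rightarrow> real) \<Rightarrow> bool" where
  "padic_complex_field p v \<longleftrightarrow>
     nonarch_absolute_value v \<and>
     (\<forall>m::int. m \<noteq> 0 \<longrightarrow> v (of_int m) = 1 / real p ^ multiplicity (int p) m) \<and>
     Metric_space.mcomplete UNIV (abs_dist v) \<and>
     (\<exists>A. is_algebraic_closure (padic_rationals v) A \<and> abs_closure v A = UNIV)"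

section \<open>Dirichlet characters\<close>

text \<open>$\overline{\mathbb{Q}}$ is the field of algebraic complex numbers; the values of the
  embedding at transcendental numbers are irrelevant.\<close>

definition qbar_embedding :: "(complex \<Rightarrow> 'c::field_char_0) \<Rightarrow> bool" where
  "qbar_embedding \<iota> \<longleftrightarrow> \<iota> 1 = 1 \<and>
     (\<forall>a b. algebraic a \<and> algebraic b \<longrightarrow>
        \<iota> (a + b) = \<iota> a + \<iota> b \<and> \<iota> (a * b) = \<iota> a * \<iota> b)"

definition dirichlet_character :: "nat \<Rightarrow> (int \<Rightarrow> complex) \<Rightarrow> bool" where
  "dirichlet_character d chi \<longleftrightarrow> d > 0 \<and>
     (\<forall>a b. chi (a * b) = chi a * chi b) \<and> (\<forall>a. chi (a + int d) = chi a) \<and>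
     (\<forall>a. chi a \<noteq> 0 \<longleftrightarrow> coprime a (int d))"

definition character_conductor :: "nat \<Rightarrow> (int \<Rightarrow> complex) \<Rightarrow> nat" where
  "character_conductor d chi = (LEAST e. e > 0 \<and> e dvd d \<and>
     (\<forall>a. coprime a (int d) \<and> [a = 1] (mod int e) \<longrightarrow> chi a = 1))"

definition primitive_dirichlet_character :: "nat \<Rightarrow> (int \<Rightarrow> complex) \<Rightarrow> bool" where
  "primitive_dirichlet_character d chi \<longleftrightarrow>
     dirichlet_character d chi \<and> character_conductor d chi = d"

section \<open>Generalized twisted Euler polynomials\<close>

text \<open>The generating function is a power series in $t$ over the ring of polynomials in $x$.
  Its factor free of $x$ is formed over the field, where division is available, and then
  mapped coefficientwise to constant polynomials. The denominator is invertible whenever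
  $\zeta^d \neq -1$.\<close>

definition twisted_euler_gf0 :: "nat \<Rightarrow> (int \<Rightarrow> 'c::field_char_0) \<Rightarrow> 'c \<Rightarrow> 'c fps" where
  "twisted_euler_gf0 d chi \<zeta> =
     fps_const 2 / (fps_const (\<zeta> ^ d) * fps_exp (of_nat d) + 1) *
     (\<Sum>a<d. fps_const ((-1) ^ a * chi (int a) * \<zeta> ^ a) * fps_exp (of_nat a))"

definition fps_exp_xt :: "'c::field_char_0 poly fps" where
  "fps_exp_xt = Abs_fps (\<lambda>n. monom (1 / fact n) n)"

definition twisted_euler_gf :: "nat \<Rightarrow> (int \<Rightarrow> 'c::field_char_0) \<Rightarrow> 'c \<Rightarrow> 'c poly fps" where
  "twisted_euler_gf d chi \<zeta> =
     fps_exp_xt * Abs_fps (\<lambda>n. [:fps_nth (twisted_euler_gf0 d chi \<zeta>) n:])"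

definition twisted_euler_poly ::
    "nat \<Rightarrow> nat \<Rightarrow> (int \<Rightarrow> 'c::field_char_0) \<Rightarrow> 'c \<Rightarrow> 'c poly" where
  "twisted_euler_poly n d chi \<zeta> = smult (fact n) (fps_nth (twisted_euler_gf d chi \<zeta>) n)"

lemma ramified_root_denominator:
  fixes \<zeta> :: "'c::field_char_0"
  assumes "odd p" "odd d" "\<zeta> ^ (p ^ s) = 1"
  shows "\<zeta> ^ d \<noteq> -1"
proof
  assume "\<zeta> ^ d = -1"
  then have "(\<zeta> ^ (p ^ s)) ^ d = (-1) ^ (p ^ s)"
    by (metis power_mult mult.commute)
  with assms show False by simp
qed

lemma twisted_euler_poly_gf:
  fixes \<zeta> :: "'c::field_char_0"
  assumes "\<zeta> ^ d \<noteq> -1"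
  shows "Abs_fps (\<lambda>n. poly (twisted_euler_poly n d chi \<zeta>) x / fact n) =
     fps_const 2 * fps_exp x / (fps_const (\<zeta> ^ d) * fps_exp (of_nat d) + 1) *
     (\<Sum>a<d. fps_const ((-1) ^ a * chi (int a) * \<zeta> ^ a) * fps_exp (of_nat a))"
proof -
  define D where "D = fps_const (\<zeta> ^ d) * fps_exp (of_nat d) + 1"
  have nz: "fps_nth D 0 \<noteq> 0"
    using assms by (simp add: D_def add_eq_0_iff2)
  have "Abs_fps (\<lambda>n. poly (twisted_euler_poly n d chi \<zeta>) x / fact n) =
      fps_exp x * twisted_euler_gf0 d chi \<zeta>"
    by (rule fps_ext)
      (simp add: twisted_euler_poly_def twisted_euler_gf_def fps_exp_xt_def fps_mult_nth
        poly_sum poly_monom mult.commute)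
  then show ?thesis
    unfolding twisted_euler_gf0_def D_def[symmetric] fps_divide_unit[OF nz]
    by (simp only: mult_ac)
qed

end

(* Up to the factor n!, each side is the nth coefficient of a product of three series
   e^(w x t) F_w(w t), where F_w(t) is the generating function at x = 0 and \<zeta> = \<xi>^w.  On both
   sides the three factors have w = w1, w2, w3, and only the arguments x are matched
   differently; the exponents w x still add up to (w1 w2 + w2 w3 + w3 w1) y, so both products
   are equal. *)
theory Submission
  imports Defs
begin

lemma fps_mult3_nth:
  fixes A B C :: "'a::comm_semiring_1 fps"
  shows "fps_nth (A * B * C) n =
    (\<Sum>(k, l, m) \<in> {(k, l, m). k + l + m = n}. fps_nth A k * fps_nth B l * fps_nth C m)"
proof -
  have "fps_nth (A * B * C) n =
      (\<Sum>i=0..n. \<Sum>j=0..n - i. fps_nth A i * fps_nth B j * fps_nth C (n - i - j))"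
    by (simp add: mult.assoc fps_mult_nth sum_distrib_left)
  also have "\<dots> = (\<Sum>(i, j) \<in> (SIGMA i:{0..n}. {0..n - i}).
      fps_nth A i * fps_nth B j * fps_nth C (n - i - j))"
    by (simp add: sum.Sigma)
  also have "\<dots> = (\<Sum>(k, l, m) \<in> {(k, l, m). k + l + m = n}.
      fps_nth A k * fps_nth B l * fps_nth C m)"
    \<comment> \<open>A triple of sum \<open>n\<close> is determined by its first two entries; since
      \<open>j\<close> is at most \<open>n - i\<close>, the truncated subtraction
      \<open>n - i - j\<close> is exact.\<close>
    by (rule sum.reindex_bij_witness
        [of _ "\<lambda>(k, l, m). (k, l)" "\<lambda>(i, j). (i, j, n - i - j)"]) auto
  finally show ?thesis .
qed

text \<open>The exponential generating function of the Euler polynomials at \<open>x\<close>, with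
  \<open>t\<close> replaced by \<open>w * t\<close>; this absorbs weights such as
  \<open>w3 ^ k\<close>.\<close>

definition scaled_euler_gf ::
    "nat \<Rightarrow> (int \<Rightarrow> 'c::field_char_0) \<Rightarrow> 'c \<Rightarrow> 'c \<Rightarrow> 'c \<Rightarrow> 'c fps" where
  "scaled_euler_gf d chi \<zeta> w x =
     Abs_fps (\<lambda>n. poly (twisted_euler_poly n d chi \<zeta>) x * w ^ n / fact n)"

text \<open>Replacing \<open>t\<close> by \<open>w * t\<close> in e^(x t) F(t) gives e^(w x t) F(w
  t), so \<open>x\<close> survives only in the exponential.\<close>

lemma scaled_euler_gf_eq:
  "scaled_euler_gf d chi \<zeta> w x = fps_exp (w * x) * scaled_euler_gf d chi \<zeta> w 0"
proof -
  define g where "g = fps_nth (twisted_euler_gf0 d chi \<zeta>)"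
  have E: "poly (twisted_euler_poly n d chi \<zeta>) z / fact n =
      (\<Sum>i=0..n. z ^ i / fact i * g (n - i))" for n z
    by (simp add: twisted_euler_poly_def twisted_euler_gf_def fps_exp_xt_def fps_mult_nth
        poly_sum poly_monom g_def mult_ac)
  have nth: "fps_nth (scaled_euler_gf d chi \<zeta> w z) n =
      (\<Sum>i=0..n. z ^ i / fact i * g (n - i)) * w ^ n" for n z
    unfolding E[symmetric] by (simp add: scaled_euler_gf_def)
  \<comment> \<open>At \<open>z = 0\<close> only the term \<open>i = 0\<close> remains, because
    \<open>0 ^ 0 = 1\<close>.\<close>
  have nth0: "fps_nth (scaled_euler_gf d chi \<zeta> w 0) n = g n * w ^ n" for n
    by (simp add: nth power_0_left if_distrib[of "\<lambda>t. t / _"] if_distrib[of "\<lambda>t. t * _"]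
        cong: if_cong)
  show ?thesis
  proof (rule fps_ext)
    fix n
    have "z ^ i / fact i * g (n - i) * w ^ n =
        (w * z) ^ i / fact i * (g (n - i) * w ^ (n - i))" if "i \<le> n" for i z
    proof -
      have "w ^ n = w ^ i * w ^ (n - i)"
        using that by (simp flip: power_add)
      then show ?thesis
        by (simp add: power_mult_distrib)
    qed
    then show "fps_nth (scaled_euler_gf d chi \<zeta> w x) n =
        fps_nth (fps_exp (w * x) * scaled_euler_gf d chi \<zeta> w 0) n"
      unfolding nth[of x] fps_mult_nth nth0 fps_exp_nth sum_distrib_right
      by (intro sum.cong) auto
  qed
qed

text \<open>The multinomial coefficient turns the sum into a coefficient of a product of three
  series. The form on the right makes the symmetry visible: the arguments enter only through
  \<open>u1 * x1 + u2 * x2 + u3 * x3\<close>, and the other factors commute.\<close>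

lemma twisted_euler_sum_eq:
  fixes x1 x2 x3 :: "'c::field_char_0"
  shows "(\<Sum>(k, l, m) \<in> {(k, l, m). k + l + m = n}.
      fact n / (fact k * fact l * fact m) *
      poly (twisted_euler_poly k d chi z1) x1 *
      poly (twisted_euler_poly l d chi z2) x2 *
      poly (twisted_euler_poly m d chi z3) x3 * u1 ^ k * u2 ^ l * u3 ^ m) =
    fact n * fps_nth (fps_exp (u1 * x1 + u2 * x2 + u3 * x3) *
      (scaled_euler_gf d chi z1 u1 0 * scaled_euler_gf d chi z2 u2 0 *
       scaled_euler_gf d chi z3 u3 0)) n" (is "?S = _ * fps_nth ?P n")
proof -
  have "?P = scaled_euler_gf d chi z1 u1 x1 * scaled_euler_gf d chi z2 u2 x2 *
      scaled_euler_gf d chi z3 u3 x3"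
    by (simp add: scaled_euler_gf_eq[of _ _ _ _ x1] scaled_euler_gf_eq[of _ _ _ _ x2]
        scaled_euler_gf_eq[of _ _ _ _ x3] fps_exp_add_mult mult_ac)
  then show ?thesis
    unfolding fps_mult3_nth \<open>?P = _\<close> sum_distrib_left
    by (simp add: scaled_euler_gf_def case_prod_unfold mult_ac)
qed

theorem theorem7:
  fixes p d n w1 w2 w3 :: nat
    and v :: "'c::field_char_0 \<Rightarrow> real"
    and \<iota> :: "complex \<Rightarrow> 'c"
    and chi :: "int \<Rightarrow> complex"
    and \<xi> y :: 'c
  assumes "prime p" and "odd p"
    and "padic_complex_field p v"
    and "qbar_embedding \<iota>"
    and "\<exists>s>0. \<xi> ^ (p ^ s) = 1"
    and "odd d"
    and "primitive_dirichlet_character d chi"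
    and "w1 > 0" and "w2 > 0" and "w3 > 0"
    and "y \<in> padic_integers v"
  shows "(\<Sum>(k, l, m) \<in> {(k, l, m). k + l + m = n}.
            fact n / (fact k * fact l * fact m) *
            poly (twisted_euler_poly k d (\<iota> \<circ> chi) (\<xi> ^ w3)) (of_nat w1 * y) *
            poly (twisted_euler_poly l d (\<iota> \<circ> chi) (\<xi> ^ w1)) (of_nat w2 * y) *
            poly (twisted_euler_poly m d (\<iota> \<circ> chi) (\<xi> ^ w2)) (of_nat w3 * y) *
            of_nat w3 ^ k * of_nat w1 ^ l * of_nat w2 ^ m) =
         (\<Sum>(k, l, m) \<in> {(k, l, m). k + l + m = n}.
            fact n / (fact k * fact l * fact m) *
            poly (twisted_euler_poly k d (\<iota> \<circ> chi) (\<xi> ^ w2)) (of_nat w1 * y) *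
            poly (twisted_euler_poly l d (\<iota> \<circ> chi) (\<xi> ^ w1)) (of_nat w3 * y) *
            poly (twisted_euler_poly m d (\<iota> \<circ> chi) (\<xi> ^ w3)) (of_nat w2 * y) *
            of_nat w2 ^ k * of_nat w1 ^ l * of_nat w3 ^ m)"
  \<comment> \<open>The exponents are \<open>w3 w1 y + w1 w2 y + w2 w3 y\<close> and
    \<open>w2 w1 y + w1 w3 y + w3 w2 y\<close>, equal up to order.\<close>
  unfolding twisted_euler_sum_eq by (simp only: ac_simps)

end
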